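(* Let $d\in\mathbf{N}$. For every $\alpha\ge 2$, the set of maximizers of $E_\alpha$ over $\mathcal{P}(\mathbf{S}^d)$ is precisely $\mathcal{P}_\Delta^=(\mathbf{S}^d)$.
   Context: $\mathbf{N}=\{1,2,\ldots\}$. $\mathbf{S}^d=\{x\in\mathbf{R}^{d+1}: |x|=1\}$ with geodesic distance $\rho(x,y)=\arccos(x\cdot y)$; $\mathcal{P}(\mathbf{S}^d)$ is the set of Borel probability measures on $\mathbf{S}^d$. Put $\Lambda(x,y)=\frac{2}{\pi}\min\{\rho(x,y),\pi-\rho(x,y)\}$ and, for $\alpha\in(0,\infty]$, $E_\alpha(\mu)=\frac12\iint\Lambda^\alpha(x,y)\,d\mu(x)\,d\mu(y)$, where $\Lambda^\infty(x,y)=1$ if $x\cdot y=0$ and $0$ otherwise. $\mathcal{P}_\Delta^=(\mathbf{S}^d)$ is the set of $\mu\in\mathcal{P}(\mathbf{S}^d)$ for which there is an orthonormal basis $\{v_0,\ldots,v_d\}$ of $\mathbf{R}^{d+1}$ with $\mu(\{v_i,-v_i\})=\frac{1}{d+1}$ for every $i=0,\ldots,d$. *)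

theory Defs
  imports "HOL-Probability.Probability"
begin

text \<open>
  The unit sphere of a Euclidean space \<open>'a\<close> is \<open>sphere 0 1\<close>. Measures on the sphere are measures
  whose underlying space is the sphere itself, with its Borel sigma-algebra as a subspace.
\<close>

definition sphere_probs :: "'a::euclidean_space measure set"
  where "sphere_probs = {\<mu>. prob_space \<mu> \<and> sets \<mu> = sets (restrict_space borel (sphere 0 1))}"

definition geodesic_dist :: "'a::euclidean_space \<Rightarrow> 'a \<Rightarrow> real"
  where "geodesic_dist x y = arccos (x \<bullet> y)"

definition Lam :: "'a::euclidean_space \<Rightarrow> 'a \<Rightarrow> real"
  where "Lam x y = 2 / pi * min (geodesic_dist x y) (pi - geodesic_dist x y)"

text \<open>
  The power \<open>\<Lambda>\<^sup>\<alpha>\<close> for \<open>0 < \<alpha> \<le> \<infinity>\<close>. On the sphere \<open>Lam\<close> takes values in \<open>[0, 1]\<close>, and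
  \<open>0 powr a = 0\<close>, so \<open>powr\<close> is the usual real power there.
\<close>

definition Lam_pow :: "ereal \<Rightarrow> 'a::euclidean_space \<Rightarrow> 'a \<Rightarrow> real"
  where "Lam_pow \<alpha> x y =
    (if \<alpha> = \<infinity> then (if x \<bullet> y = 0 then 1 else 0) else Lam x y powr real_of_ereal \<alpha>)"

text \<open>
  The integrand is bounded and Borel measurable on the product of two spheres for every
  \<open>\<alpha> \<in> (0, \<infinity>]\<close>, so the iterated Bochner integrals never take their default value 0.
\<close>

definition energy :: "ereal \<Rightarrow> 'a::euclidean_space measure \<Rightarrow> real"
  where "energy \<alpha> \<mu> = 1 / 2 * (\<integral>x. (\<integral>y. Lam_pow \<alpha> x y \<partial>\<mu>) \<partial>\<mu>)"

text \<open>Linear independence of \<open>B\<close> follows from orthogonality, as the vectors are nonzero.\<close>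

definition orthonormal_basis :: "'a::euclidean_space set \<Rightarrow> bool"
  where "orthonormal_basis B \<longleftrightarrow>
    pairwise orthogonal B \<and> (\<forall>v\<in>B. norm v = 1) \<and> span B = UNIV"

definition Delta_eq_probs :: "'a::euclidean_space measure set"
  where "Delta_eq_probs =
    {\<mu> \<in> sphere_probs. \<exists>B. orthonormal_basis B \<and> (\<forall>v\<in>B. measure \<mu> {v, - v} = 1 / real DIM('a))}"

end

theory Submission
  imports Defs
begin

text \<open>
  For \<open>\<theta> = min (\<rho> x y) (\<pi> - \<rho> x y)\<close>, Jordan's inequality \<open>2\<theta>/\<pi> \<le> sin \<theta>\<close> gives
  \<open>\<Lambda>\<^sup>\<alpha> \<le> \<Lambda>\<^sup>2 \<le> 1 - (x \<bullet> y)\<^sup>2\<close>, with equality only for parallel or orthogonal \<open>x, y\<close>. The frame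
  potential \<open>\<integral>\<integral>(x \<bullet> y)\<^sup>2\<close> is the squared Hilbert-Schmidt norm of the second moment matrix, which
  has trace 1; in dimension \<open>N\<close> it is thus at least \<open>1/N\<close>, with equality only if that matrix is
  \<open>I/N\<close>. So the energy is at most \<open>(1 - 1/N)/2\<close>. In case of equality, almost every \<open>x\<close> is
  parallel or orthogonal to almost every \<open>y\<close>, so that \<open>\<mu> {x, -x} = \<integral>(x \<bullet> y)\<^sup>2 d\<mu>(y) = 1/N\<close>; a largest
  orthogonal set of such \<open>x\<close> is a basis, since otherwise the lines through it miss some mass.
\<close>

section \<open>Pointwise comparison of \<open>Lam_pow\<close> with
  \<open>1 - (x \<bullet> y)\<^sup>2\<close>\<close>

text \<open>Compare the slopes of the sine's chords over \<open>[0, x]\<close> and \<open>[x, \<pi>/2]\<close>.\<close>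
lemma Jordan_sin_strict:
  fixes x :: real
  assumes "0 < x" "x < pi / 2"
  shows "2 / pi * x < sin x"
proof -
  obtain u where u: "0 < u" "u < x" "sin x - sin 0 = (x - 0) * cos u"
    using MVT2[of 0 x sin cos] assms by (auto intro: DERIV_sin)
  obtain v where v: "x < v" "v < pi / 2" "sin (pi / 2) - sin x = (pi / 2 - x) * cos v"
    using MVT2[of x "pi / 2" sin cos] assms by (auto intro: DERIV_sin)
  have "cos v < cos u"
    using u v assms by (intro cos_monotone_0_pi) auto
  then have "x * ((pi / 2 - x) * cos v) < (pi / 2 - x) * (x * cos u)"
    using assms by (simp add: mult.left_commute)
  then have "x * (1 - sin x) < (pi / 2 - x) * sin x"
    using u(3) v(3) by simp
  then have "x < pi / 2 * sin x"
    by (simp add: algebra_simps)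
  then show ?thesis
    by (simp add: field_simps)
qed

lemma abs_inner_unit_le_1:
  fixes x y :: "'a::real_inner"
  assumes "norm x = 1" "norm y = 1"
  shows "\<bar>x \<bullet> y\<bar> \<le> 1"
  using Cauchy_Schwarz_ineq2[of x y] assms by simp

text \<open>The equality case of Cauchy-Schwarz: for unit vectors the squared norms of
  \<open>y - x\<close> and \<open>y + x\<close> are \<open>2 - 2 * (x \<bullet> y)\<close> and
  \<open>2 + 2 * (x \<bullet> y)\<close>, so one of them vanishes.\<close>

lemma inner_unit_eq_pm1_iff:
  fixes x y :: "'a::real_inner"
  assumes "norm x = 1" "norm y = 1"
  shows "\<bar>x \<bullet> y\<bar> = 1 \<longleftrightarrow> y \<in> {x, - x}"
proof
  assume "\<bar>x \<bullet> y\<bar> = 1"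
  moreover have "(norm (y - x))\<^sup>2 = 2 - 2 * (x \<bullet> y)" "(norm (y + x))\<^sup>2 = 2 + 2 * (x \<bullet> y)"
    using assms dot_norm[of y x] dot_norm_neg[of y x] by (simp_all add: inner_commute field_simps)
  ultimately have "norm (y - x) = 0 \<or> norm (y + x) = 0"
    by (auto simp: abs_if split: if_splits)
  then show "y \<in> {x, - x}"
    by (auto simp: eq_neg_iff_add_eq_0)
next
  assume "y \<in> {x, - x}"
  then show "\<bar>x \<bullet> y\<bar> = 1"
    using assms by (auto simp: dot_square_norm)
qed

text \<open>The angle \<theta> between the lines through \<open>x\<close> and \<open>y\<close> has
  squared sine \<open>1 - (x \<bullet> y)\<^sup>2\<close>. The excluded inner products are those
  with \<theta> = 0 or \<theta> = \<pi>/2, where Jordan's inequality is an equality.\<close>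

lemma Lam_less_sin:
  fixes x y :: "'a::euclidean_space"
  assumes "norm x = 1" "norm y = 1" "x \<bullet> y \<notin> {-1, 0, 1}"
  shows "0 < Lam x y" "(Lam x y)\<^sup>2 < 1 - (x \<bullet> y)\<^sup>2"
proof -
  define t \<theta> where "t = x \<bullet> y" and "\<theta> = min (arccos t) (pi - arccos t)"
  have t: "-1 < t" "t < 1" "t \<noteq> 0"
    using abs_inner_unit_le_1[OF assms(1,2)] assms(3) by (auto simp: t_def)
  have Lam: "Lam x y = 2 / pi * \<theta>"
    by (simp add: Lam_def geodesic_dist_def t_def \<theta>_def)
  have arc: "0 < arccos t" "arccos t < pi"
    using arccos_lt_bounded t by auto
  have "arccos t \<noteq> pi / 2"
    using t by (metis cos_arccos cos_pi_half less_imp_le)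
  then have \<theta>: "0 < \<theta>" "\<theta> < pi / 2"
    using arc by (auto simp: \<theta>_def min_def)
  have "sin \<theta> = sqrt (1 - t\<^sup>2)"
    using t by (auto simp: \<theta>_def min_def sin_arccos)
  moreover have "t\<^sup>2 < 1"
    using t by (simp add: abs_square_less_1)
  ultimately have sin: "(sin \<theta>)\<^sup>2 = 1 - t\<^sup>2"
    by simp
  show pos: "0 < Lam x y"
    using \<theta> by (simp add: Lam)
  have "(Lam x y)\<^sup>2 < (sin \<theta>)\<^sup>2"
    using Jordan_sin_strict[OF \<theta>] pos by (intro power_strict_mono) (auto simp: Lam)
  then show "(Lam x y)\<^sup>2 < 1 - (x \<bullet> y)\<^sup>2"
    using sin by (simp add: t_def)
qed

text \<open>For finite \<alpha>, the power of a number in (0, 1] decreases in the exponent, so the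
  case of exponent 2 suffices. For \<alpha> = \<infinity> the left side is 0 because
  \<open>x \<bullet> y\<close> is nonzero.\<close>

lemma Lam_pow_less:
  fixes x y :: "'a::euclidean_space"
  assumes "\<alpha> \<ge> 2" "norm x = 1" "norm y = 1" "x \<bullet> y \<notin> {-1, 0, 1}"
  shows "Lam_pow \<alpha> x y < 1 - (x \<bullet> y)\<^sup>2"
proof -
  have lt1: "(x \<bullet> y)\<^sup>2 < 1"
    using abs_inner_unit_le_1[OF assms(2,3)] assms(4) by (auto simp: abs_square_less_1)
  note L = Lam_less_sin[OF assms(2-4)]
  have "(Lam x y)\<^sup>2 \<le> 1\<^sup>2"
    using L(2) by (smt (verit) one_power2 zero_le_power2)
  then have "Lam x y \<le> 1"
    by (rule power2_le_imp_le) simp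
  then have "Lam x y powr r < 1 - (x \<bullet> y)\<^sup>2" if "2 \<le> r" for r
    using powr_mono'[OF that, of "Lam x y"] L by (simp add: powr_numeral)
  then show ?thesis
    using assms lt1 by (cases \<alpha>) (auto simp: Lam_pow_def)
qed

text \<open>For parallel vectors both sides are 0, with \<open>0 powr a = 0\<close> covering finite
  \<alpha>; for orthogonal ones \<open>Lam x y\<close> is 1.\<close>

lemma Lam_pow_eq:
  fixes x y :: "'a::euclidean_space"
  assumes "\<alpha> \<ge> 2" "x \<bullet> y \<in> {-1, 0, 1}"
  shows "Lam_pow \<alpha> x y = 1 - (x \<bullet> y)\<^sup>2"
  using assms by (cases \<alpha>) (auto simp: Lam_pow_def Lam_def geodesic_dist_def)

lemma Lam_pow_le:
  fixes x y :: "'a::euclidean_space"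
  assumes "\<alpha> \<ge> 2" "norm x = 1" "norm y = 1"
  shows "Lam_pow \<alpha> x y \<le> 1 - (x \<bullet> y)\<^sup>2"
  using Lam_pow_less[OF assms] Lam_pow_eq[OF assms(1), of x y] by force

lemma Lam_pow_nonneg: "0 \<le> Lam_pow \<alpha> x y"
  by (simp add: Lam_pow_def)

section \<open>Measurability and integrability on the sphere\<close>

locale sphere_prob = prob_space \<mu> for \<mu> :: "'a::euclidean_space measure" +
  assumes sets_eq: "sets \<mu> = sets (restrict_space borel (sphere 0 1))"
begin

lemma space_eq: "space \<mu> = sphere 0 1"
  using sets_eq_imp_space_eq[OF sets_eq] by (simp add: space_restrict_space)

lemma norm_space [simp]: "x \<in> space \<mu> \<Longrightarrow> norm x = 1"
  by (simp add: space_eq)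

lemma measurable_id [measurable]: "(\<lambda>x. x) \<in> borel_measurable \<mu>"
  using measurable_cong_sets[OF sets_eq refl, of borel] measurable_restrict_space1[OF measurable_ident]
  by (auto simp: id_def)

lemma borel_subset_sets: "A \<in> sets borel \<Longrightarrow> A \<subseteq> sphere 0 1 \<Longrightarrow> A \<in> sets \<mu>"
  by (auto simp: sets_eq sets_restrict_space_iff)

lemma integrable_bounded:
  fixes f :: "'a \<Rightarrow> real"
  assumes "f \<in> borel_measurable \<mu>" "\<And>x. norm x = 1 \<Longrightarrow> \<bar>f x\<bar> \<le> C"
  shows "integrable \<mu> f"
  using assms by (intro integrable_const_bound[of _ C]) auto

lemma measurable_Lam_pow [measurable]:
  "(\<lambda>(x, y). Lam_pow \<alpha> x y) \<in> borel_measurable (\<mu> \<Otimes>\<^sub>M \<mu>)"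
proof -
  \<comment> \<open>\<open>arccos\<close> is unspecified outside \<open>[-1, 1]\<close>, so its argument is clamped.\<close>
  define c where "c t = max (-1) (min 1 t)" for t :: real
  have "continuous_on UNIV (\<lambda>t. arccos (c t))"
    unfolding c_def by (intro continuous_intros) auto
  then have [measurable]: "(\<lambda>t. arccos (c t)) \<in> borel_measurable borel"
    by (rule borel_measurable_continuous_onI)
  define L where "L x y = (if \<alpha> = \<infinity> then (if x \<bullet> y = 0 then 1 else 0) else
    (2 / pi * min (arccos (c (x \<bullet> y))) (pi - arccos (c (x \<bullet> y)))) powr real_of_ereal \<alpha>)"
    for x y :: 'a
  have "(\<lambda>(x, y). L x y) \<in> borel_measurable (\<mu> \<Otimes>\<^sub>M \<mu>)"
    unfolding L_def by measurable
  moreover have "L x y = Lam_pow \<alpha> x y" if "x \<in> space \<mu>" "y \<in> space \<mu>" for x y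
  proof -
    have "c (x \<bullet> y) = x \<bullet> y"
      using abs_inner_unit_le_1[of x y] that by (auto simp: c_def)
    then show ?thesis
      by (simp add: L_def Lam_pow_def Lam_def geodesic_dist_def)
  qed
  ultimately show ?thesis
    by (subst measurable_cong[where g = "\<lambda>(x, y). L x y"]) (auto simp: space_pair_measure)
qed

section \<open>Second moments and the frame potential\<close>

definition moment :: "'a \<Rightarrow> 'a \<Rightarrow> real"
  where "moment i j = (\<integral>y. (i \<bullet> y) * (j \<bullet> y) \<partial>\<mu>)"

lemma integrable_moment:
  assumes "i \<in> Basis" "j \<in> Basis"
  shows "integrable \<mu> (\<lambda>y. (i \<bullet> y) * (j \<bullet> y))"
proof (rule integrable_bounded[where C = 1])
  fix y :: 'a assume "norm y = 1"
  then have "\<bar>i \<bullet> y\<bar> \<le> 1" "\<bar>j \<bullet> y\<bar> \<le> 1"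
    using assms by (auto intro!: abs_inner_unit_le_1)
  then show "\<bar>(i \<bullet> y) * (j \<bullet> y)\<bar> \<le> 1"
    by (simp add: abs_mult mult_le_one)
qed measurable

text \<open>This separates the variables: the square is the Hilbert-Schmidt inner product of the
  rank-one matrices of \<open>x\<close> and \<open>y\<close>, so integrating over \<open>y\<close>
  leaves only second moments.\<close>

lemma inner_square_expand:
  "((x::'a) \<bullet> y)\<^sup>2 = (\<Sum>i\<in>Basis. \<Sum>j\<in>Basis. (i \<bullet> x) * (j \<bullet> x) * ((i \<bullet> y) * (j \<bullet> y)))"
  by (subst euclidean_inner)
    (simp add: power2_eq_square sum_product inner_commute mult_ac)

lemma integral_inner_square:
  "(\<integral>y. (x \<bullet> y)\<^sup>2 \<partial>\<mu>) = (\<Sum>i\<in>Basis. \<Sum>j\<in>Basis. (i \<bullet> x) * (j \<bullet> x) * moment i j)"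
  unfolding inner_square_expand moment_def
  by (simp add: integrable_moment)

text \<open>The trace of the moment matrix is the mean of \<open>y \<bullet> y\<close>, which is 1
  on the sphere.\<close>

lemma sum_moment_diag: "(\<Sum>i\<in>Basis. moment i i) = 1"
proof -
  have "(\<Sum>i\<in>Basis. moment i i) = (\<integral>y. (\<Sum>i\<in>Basis. (i \<bullet> y) * (i \<bullet> y)) \<partial>\<mu>)"
    unfolding moment_def by (simp add: integrable_moment)
  also have "\<dots> = (\<integral>y. 1 \<partial>\<mu>)"
  proof (rule Bochner_Integration.integral_cong)
    fix y assume "y \<in> space \<mu>"
    then have "y \<bullet> y = 1"
      by (simp add: dot_square_norm)
    then show "(\<Sum>i\<in>Basis. (i \<bullet> y) * (i \<bullet> y)) = 1"
      by (subst (asm) euclidean_inner) (simp add: inner_commute)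
  qed simp
  finally show ?thesis
    by (simp add: prob_space)
qed

text \<open>The squared Hilbert-Schmidt distance of the moment matrix from I/N, where N is the
  dimension.\<close>

definition frame_defect :: real
  where "frame_defect =
    (\<Sum>i\<in>Basis. \<Sum>j\<in>Basis. (moment i j - (if i = j then 1 / real DIM('a) else 0))\<^sup>2)"

text \<open>The frame potential is the sum of the squared moments. Expanding the defect, the trace
  condition turns the cross terms into -2/N, while the constants add up to 1/N.\<close>

lemma frame_potential:
  "(\<integral>x. (\<integral>y. (x \<bullet> y)\<^sup>2 \<partial>\<mu>) \<partial>\<mu>) = 1 / real DIM('a) + frame_defect"
proof -
  let ?N = "real DIM('a)"
  have "(\<integral>x. (\<integral>y. (x \<bullet> y)\<^sup>2 \<partial>\<mu>) \<partial>\<mu>)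
      = (\<integral>x. (\<Sum>i\<in>Basis. \<Sum>j\<in>Basis. (i \<bullet> x) * (j \<bullet> x) * moment i j) \<partial>\<mu>)"
    by (simp add: integral_inner_square)
  also have "\<dots> = (\<Sum>i\<in>Basis. \<Sum>j\<in>Basis. (moment i j)\<^sup>2)"
    by (simp add: integrable_moment power2_eq_square flip: moment_def)
  finally have 1: "(\<integral>x. (\<integral>y. (x \<bullet> y)\<^sup>2 \<partial>\<mu>) \<partial>\<mu>) = (\<Sum>i\<in>Basis. \<Sum>j\<in>Basis. (moment i j)\<^sup>2)" .
  have "frame_defect = (\<Sum>i\<in>Basis. \<Sum>j\<in>Basis.
      (moment i j)\<^sup>2 + (if i = j then (1 / ?N)\<^sup>2 - 2 / ?N * moment i i else 0))"
    unfolding frame_defect_def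
    by (intro sum.cong refl) (simp add: power2_eq_square algebra_simps)
  also have "\<dots> = (\<Sum>i\<in>Basis. \<Sum>j\<in>Basis. (moment i j)\<^sup>2)
      + (?N * (1 / ?N)\<^sup>2 - 2 / ?N * (\<Sum>i\<in>Basis. moment i i))"
    by (simp add: sum.distrib sum_subtractf sum_distrib_left)
  also have "\<dots> = (\<Sum>i\<in>Basis. \<Sum>j\<in>Basis. (moment i j)\<^sup>2) - 1 / ?N"
    by (simp add: sum_moment_diag power2_eq_square)
  finally show ?thesis
    using 1 by simp
qed

lemma frame_defect_nonneg: "0 \<le> frame_defect"
  unfolding frame_defect_def by (intro sum_nonneg) auto

text \<open>A vanishing defect makes the moment matrix I/N, whose quadratic form at a unit vector is
  1/N.\<close>

lemma tight_frame:
  assumes "frame_defect = 0" "norm x = 1"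
  shows "(\<integral>y. (x \<bullet> y)\<^sup>2 \<partial>\<mu>) = 1 / real DIM('a)"
proof -
  have "moment i j = (if i = j then 1 / real DIM('a) else 0)" if "i \<in> Basis" "j \<in> Basis" for i j
    using assms(1) that unfolding frame_defect_def
    by (subst (asm) sum_nonneg_eq_0_iff; simp add: sum_nonneg)
      (subst (asm) sum_nonneg_eq_0_iff; auto)
  then have "(\<integral>y. (x \<bullet> y)\<^sup>2 \<partial>\<mu>)
      = (\<Sum>i\<in>Basis. \<Sum>j\<in>Basis. if i = j then (i \<bullet> x) * (i \<bullet> x) / real DIM('a) else 0)"
    unfolding integral_inner_square by (intro sum.cong refl) auto
  also have "\<dots> = (x \<bullet> x) / real DIM('a)"
    by (subst euclidean_inner) (simp add: inner_commute sum_divide_distrib)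
  finally show ?thesis
    using assms(2) by (simp add: dot_square_norm)
qed

section \<open>The pointwise gap and the upper bound on the energy\<close>

definition gap :: "ereal \<Rightarrow> 'a \<Rightarrow> 'a \<Rightarrow> real"
  where "gap \<alpha> x y = 1 - (x \<bullet> y)\<^sup>2 - Lam_pow \<alpha> x y"

lemma measurable_gap [measurable]: "(\<lambda>(x, y). gap \<alpha> x y) \<in> borel_measurable (\<mu> \<Otimes>\<^sub>M \<mu>)"
  unfolding gap_def by measurable

context
  fixes \<alpha> :: ereal
  assumes \<alpha>: "\<alpha> \<ge> 2"
begin

lemma gap_bounds: "norm x = 1 \<Longrightarrow> norm y = 1 \<Longrightarrow> 0 \<le> gap \<alpha> x y \<and> gap \<alpha> x y \<le> 1"
  using Lam_pow_le[OF \<alpha>, of x y] Lam_pow_nonneg[of \<alpha> x y]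
  by (simp add: gap_def) (smt (verit) zero_le_power2)

lemma integrable_gap:
  assumes "x \<in> space \<mu>"
  shows "integrable \<mu> (gap \<alpha> x)"
proof (rule integrable_bounded[where C = 1])
  show "gap \<alpha> x \<in> borel_measurable \<mu>"
    using measurable_compose[OF measurable_Pair1'[OF assms] measurable_gap[of \<alpha>]] by simp
qed (use gap_bounds assms in \<open>auto simp: abs_le_iff\<close>)

lemma integrable_square:
  assumes "norm x = 1"
  shows "integrable \<mu> (\<lambda>y. (x \<bullet> y)\<^sup>2)"
  by (rule integrable_bounded[where C = 1])
    (use abs_inner_unit_le_1[OF assms] in \<open>auto simp: abs_square_le_1\<close>)

lemma integral_gap_bounds:
  assumes "norm x = 1"
  shows "0 \<le> (\<integral>y. gap \<alpha> x y \<partial>\<mu>)" "(\<integral>y. gap \<alpha> x y \<partial>\<mu>) \<le> 1"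
proof -
  have x: "x \<in> space \<mu>"
    using assms by (simp add: space_eq)
  show "0 \<le> (\<integral>y. gap \<alpha> x y \<partial>\<mu>)"
    using gap_bounds assms by (intro integral_nonneg_AE) auto
  show "(\<integral>y. gap \<alpha> x y \<partial>\<mu>) \<le> 1"
    using gap_bounds assms integrable_gap[OF x] by (intro integral_le_const) auto
qed

lemma integrable_integral_gap: "integrable \<mu> (\<lambda>x. \<integral>y. gap \<alpha> x y \<partial>\<mu>)"
  by (rule integrable_bounded[where C = 1]) (use integral_gap_bounds in \<open>auto simp: abs_le_iff\<close>)

text \<open>Integrating the definition of \<open>gap\<close> splits the shortfall from the bound
  into two nonnegative terms: the defect of the moment matrix and the mean gap of the
  kernel.\<close>

lemma energy_eq:
  "energy \<alpha> \<mu> = 1 / 2 * (1 - 1 / real DIM('a) - frame_defect - (\<integral>x. (\<integral>y. gap \<alpha> x y \<partial>\<mu>) \<partial>\<mu>))"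
proof -
  have "integrable \<mu> (\<lambda>x. \<integral>y. (x \<bullet> y)\<^sup>2 \<partial>\<mu>)"
    unfolding integral_inner_square
    by (intro Bochner_Integration.integrable_sum integrable_mult_left integrable_moment)
  moreover have "(\<integral>y. Lam_pow \<alpha> x y \<partial>\<mu>) = 1 - (\<integral>y. (x \<bullet> y)\<^sup>2 \<partial>\<mu>) - (\<integral>y. gap \<alpha> x y \<partial>\<mu>)"
    if "x \<in> space \<mu>" for x
  proof -
    have "(\<integral>y. Lam_pow \<alpha> x y \<partial>\<mu>) = (\<integral>y. 1 - (x \<bullet> y)\<^sup>2 - gap \<alpha> x y \<partial>\<mu>)"
      by (simp add: gap_def)
    then show ?thesis
      using integrable_square[of x] integrable_gap[OF that] that by (simp add: prob_space)
  qed
  then have "(\<integral>x. (\<integral>y. Lam_pow \<alpha> x y \<partial>\<mu>) \<partial>\<mu>)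
      = (\<integral>x. 1 - (\<integral>y. (x \<bullet> y)\<^sup>2 \<partial>\<mu>) - (\<integral>y. gap \<alpha> x y \<partial>\<mu>) \<partial>\<mu>)"
    by (intro Bochner_Integration.integral_cong) auto
  ultimately show ?thesis
    using integrable_integral_gap by (simp add: energy_def prob_space frame_potential)
qed

lemma integral_gap_nonneg: "0 \<le> (\<integral>x. (\<integral>y. gap \<alpha> x y \<partial>\<mu>) \<partial>\<mu>)"
  using integral_gap_bounds by (intro integral_nonneg_AE) auto

lemma energy_le: "energy \<alpha> \<mu> \<le> 1 / 2 * (1 - 1 / real DIM('a))"
  using integral_gap_nonneg frame_defect_nonneg by (simp add: energy_eq)

section \<open>The equality case\<close>

lemma Delta_eq_if_energy_eq:
  assumes "energy \<alpha> \<mu> = 1 / 2 * (1 - 1 / real DIM('a))"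
  shows "\<exists>B. orthonormal_basis B \<and> (\<forall>v\<in>B. prob {v, - v} = 1 / real DIM('a))"
proof -
  \<comment> \<open>Both terms of the shortfall are nonnegative, so each of them vanishes.\<close>
  have defect: "frame_defect = 0" and "(\<integral>x. (\<integral>y. gap \<alpha> x y \<partial>\<mu>) \<partial>\<mu>) = 0"
    using assms integral_gap_nonneg frame_defect_nonneg by (auto simp: energy_eq)
  then have "AE x in \<mu>. (\<integral>y. gap \<alpha> x y \<partial>\<mu>) = 0"
    using integral_gap_bounds
    by (subst (asm) integral_nonneg_eq_0_iff_AE[OF integrable_integral_gap]) auto
  \<comment> \<open>Good points are parallel or orthogonal to almost every point. Almost every point
    is good, since a nonnegative function with integral 0 vanishes almost everywhere; this is used
    for the outer integral and then for the inner one.\<close>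
  define good where "good x \<longleftrightarrow> norm x = 1 \<and> (AE y in \<mu>. x \<bullet> y \<in> {-1, 0, 1})" for x
  have AE_good: "AE x in \<mu>. good x"
    using AE_space \<open>AE x in \<mu>. _\<close>
  proof eventually_elim
    case (elim x)
    then have "AE y in \<mu>. gap \<alpha> x y = 0"
      using gap_bounds by (subst (asm) integral_nonneg_eq_0_iff_AE[OF integrable_gap]) auto
    then have "AE y in \<mu>. x \<bullet> y \<in> {-1, 0, 1}"
      using AE_space
    proof eventually_elim
      case (elim y)
      then show ?case
        using Lam_pow_less[OF \<alpha>, of x y] \<open>x \<in> space \<mu>\<close> by (force simp: gap_def)
    qed
    then show ?case
      using elim by (simp add: good_def)
  qed
  have good_sets: "{x, - x} \<in> sets \<mu>" if "good x" for x
    using that by (intro borel_subset_sets) (auto simp: good_def)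
  have good_prob: "prob {x, - x} = 1 / real DIM('a)" if "good x" for x
  proof -
    \<comment> \<open>With inner products in {-1, 0, 1}, the square is 1 exactly on
      \<open>{x, - x}\<close>, so \<open>tight_frame\<close> computes the mass of this pair.\<close>
    have "(\<integral>y. (x \<bullet> y)\<^sup>2 \<partial>\<mu>) = (\<integral>y. indicator {x, - x} y \<partial>\<mu>)"
    proof (rule integral_cong_AE)
      have x: "norm x = 1" and "AE y in \<mu>. x \<bullet> y \<in> {-1, 0, 1}"
        using that by (auto simp: good_def)
      from this(2) show "AE y in \<mu>. (x \<bullet> y)\<^sup>2 = indicator {x, - x} y"
        using AE_space
      proof eventually_elim
        case (elim y)
        then have "\<bar>x \<bullet> y\<bar> = 1 \<longleftrightarrow> y \<in> {x, - x}"
          by (intro inner_unit_eq_pm1_iff x) auto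
        then show ?case
          using elim by (auto simp: indicator_def)
      qed
    qed (use good_sets[OF that] in measurable)
    then show ?thesis
      using tight_frame[OF defect, of x] that good_sets[OF that] sets.sets_into_space[OF good_sets[OF that]]
      by (simp add: good_def Int_absorb2)
  qed
  define ortho where "ortho B \<longleftrightarrow> pairwise orthogonal B \<and> (\<forall>v\<in>B. good v)" for B
  have ortho_indep: "independent B" if "ortho B" for B
    using that by (intro pairwise_orthogonal_independent) (auto simp: ortho_def good_def)
  then have bound: "finite B" "card B \<le> DIM('a)" if "ortho B" for B
    using independent_bound that by blast+
  have "ortho {}"
    by (simp add: ortho_def pairwise_def)
  \<comment> \<open>Orthogonal sets of good points are independent, so their size is bounded and a
    largest one exists; \<open>Suc\<close> makes the bound strict.\<close>
  then obtain B where B: "ortho B" "\<And>C. ortho C \<Longrightarrow> card C \<le> card B"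
    using ex_has_greatest_nat[of ortho "{}" card "Suc (DIM('a))"] bound(2) by (metis le_imp_less_Suc)
  \<comment> \<open>Fewer than N pairs, each of mass 1/N, leave positive mass uncovered. A suitable
    good point there is orthogonal to all of \<open>B\<close>, and adding it contradicts
    maximality.\<close>
  have "card B = DIM('a)"
  proof (rule ccontr)
    assume "card B \<noteq> DIM('a)"
    then have less: "card B < DIM('a)"
      using bound[OF B(1)] by simp
    let ?U = "\<Union>v\<in>B. {v, - v}"
    have U: "?U \<in> sets \<mu>"
      using bound[OF B(1)] B(1) good_sets by (auto simp: ortho_def)
    have "prob ?U \<le> (\<Sum>v\<in>B. prob {v, - v})"
      using bound[OF B(1)] B(1) good_sets
      by (intro finite_measure_subadditive_finite) (auto simp: ortho_def)
    also have "\<dots> = real (card B) / real DIM('a)"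
      using B(1) good_prob by (simp add: ortho_def)
    also have "\<dots> < 1"
      using less by simp
    finally have "\<not> (AE x in \<mu>. x \<in> ?U)"
      using prob_eq_1[OF U] by simp
    \<comment> \<open>The relation between \<open>x\<close> and \<open>B\<close> must come from the
      goodness of each \<open>v\<close> in \<open>B\<close>: goodness of \<open>x\<close> constrains
      only almost every point and could miss \<open>v\<close>. Finiteness of \<open>B\<close> keeps
      the exceptional set null.\<close>
    moreover have "AE x in \<mu>. \<forall>v\<in>B. v \<bullet> x \<in> {-1, 0, 1}"
      using bound[OF B(1)] B(1) by (intro AE_finite_allI) (auto simp: ortho_def good_def)
    then have "AE x in \<mu>. good x \<and> (\<forall>v\<in>B. v \<bullet> x \<in> {-1, 0, 1})"
      using AE_good by eventually_elim blast
    ultimately have "\<exists>x. (good x \<and> (\<forall>v\<in>B. v \<bullet> x \<in> {-1, 0, 1})) \<and> x \<notin> ?U"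
      using eventually_mono[of _ "ae_filter \<mu>" "\<lambda>x. x \<in> ?U"] by blast
    then obtain x where x: "good x" "\<And>v. v \<in> B \<Longrightarrow> v \<bullet> x \<in> {-1, 0, 1}" "x \<notin> ?U"
      by blast
    have "v \<bullet> x = 0" if "v \<in> B" for v
    proof -
      have "\<bar>v \<bullet> x\<bar> \<noteq> 1"
        using that x(1,3) B(1) inner_unit_eq_pm1_iff[of v x] by (auto simp: ortho_def good_def)
      then show ?thesis
        using x(2)[OF that] by auto
    qed
    then have "ortho (insert x B)"
      using B(1) x(1) by (auto simp: ortho_def pairwise_insert orthogonal_def inner_commute)
    moreover have "x \<notin> B"
      using x(3) by blast
    ultimately show False
      using B(2)[of "insert x B"] bound[OF B(1)] by simp
  qed
  then have "span B = UNIV"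
    using card_ge_dim_independent[of B UNIV] ortho_indep[OF B(1)] by auto
  then show ?thesis
    using B(1) good_prob by (auto simp: orthonormal_basis_def ortho_def good_def)
qed

section \<open>The measures in \<open>Delta_eq_probs\<close> attain the bound\<close>

lemma energy_eq_if_Delta_eq:
  assumes B: "orthonormal_basis B" and prob: "\<forall>v\<in>B. prob {v, - v} = 1 / real DIM('a)"
  shows "energy \<alpha> \<mu> = 1 / 2 * (1 - 1 / real DIM('a))"
proof -
  have unit: "norm v = 1" if "v \<in> B" for v
    using B that by (simp add: orthonormal_basis_def)
  have ortho: "v \<bullet> w = 0" if "v \<in> B" "w \<in> B" "v \<noteq> w" for v w
    using B that by (auto simp: orthonormal_basis_def pairwise_def orthogonal_def)
  have "independent B"
    using B by (intro pairwise_orthogonal_independent) (auto simp: orthonormal_basis_def)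
  then have "finite B" and card: "card B = DIM('a)"
    using B dim_eq_card[of B UNIV] independent_bound by (auto simp: orthonormal_basis_def)
  let ?U = "\<Union>v\<in>B. {v, - v}"
  have sets: "{v, - v} \<in> sets \<mu>" if "v \<in> B" for v
    using unit[OF that] by (intro borel_subset_sets) auto
  \<comment> \<open>Disjointness makes the masses of the N pairs add up to 1, so all integrals may
    be computed on \<open>?U\<close>.\<close>
  have "disjoint_family_on (\<lambda>v. {v, - v}) B"
    unfolding disjoint_family_on_def
  proof (intro ballI impI)
    fix v w assume vw: "v \<in> B" "w \<in> B" "v \<noteq> w"
    have "v \<noteq> - w"
    proof
      assume "v = - w"
      then have "v \<bullet> v = 0"
        using ortho[OF vw] by (metis inner_minus_right neg_0_equal_iff_equal)
      then show False
        using unit[OF vw(1)] by simp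
    qed
    then show "{v, - v} \<inter> {w, - w} = {}"
      using vw(3) by (auto simp: minus_equation_iff)
  qed
  then have "prob ?U = (\<Sum>v\<in>B. prob {v, - v})"
    using \<open>finite B\<close> sets by (intro finite_measure_finite_Union) auto
  also have "\<dots> = 1"
    using prob card by simp
  finally have AE_U: "AE x in \<mu>. x \<in> ?U"
    by (rule AE_prob_1)
  have inner: "x \<bullet> y \<in> {-1, 0, 1}" if xy: "x \<in> ?U" "y \<in> ?U" for x y
  proof -
    obtain v w where vw: "v \<in> B" "x = v \<or> x = - v" "w \<in> B" "y = w \<or> y = - w"
      using xy by blast
    moreover have "v \<bullet> w \<in> {0, 1}"
      using ortho[OF vw(1,3)] unit[OF vw(1)] by (cases "v = w") (auto simp: dot_square_norm)
    ultimately show ?thesis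
      by auto
  qed
  have "(\<integral>x. (\<integral>y. gap \<alpha> x y \<partial>\<mu>) \<partial>\<mu>) = 0"
  proof (rule integral_eq_zero_AE)
    show "AE x in \<mu>. (\<integral>y. gap \<alpha> x y \<partial>\<mu>) = 0"
      using AE_U
    proof eventually_elim
      case (elim x)
      show ?case
      proof (rule integral_eq_zero_AE)
        show "AE y in \<mu>. gap \<alpha> x y = 0"
          using AE_U
        proof eventually_elim
          case (elim y)
          show ?case
            using Lam_pow_eq[OF \<alpha> inner[OF \<open>x \<in> ?U\<close> elim]] by (simp add: gap_def)
        qed
      qed
    qed
  qed
  \<comment> \<open>For \<open>x\<close> in a pair, the squared inner product is the indicator of
    that pair, with integral 1/N. Comparing the resulting value with \<open>frame_potential\<close>
    gives \<open>frame_defect\<close> = 0.\<close>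
  moreover have "(\<integral>x. (\<integral>y. (x \<bullet> y)\<^sup>2 \<partial>\<mu>) \<partial>\<mu>) = (\<integral>x. 1 / real DIM('a) \<partial>\<mu>)"
  proof (rule integral_cong_AE)
    show "AE x in \<mu>. (\<integral>y. (x \<bullet> y)\<^sup>2 \<partial>\<mu>) = 1 / real DIM('a)"
      using AE_U
    proof eventually_elim
      case (elim x)
      then obtain v where v: "v \<in> B" "x = v \<or> x = - v"
        by blast
      have "(\<integral>y. (x \<bullet> y)\<^sup>2 \<partial>\<mu>) = (\<integral>y. indicator {v, - v} y \<partial>\<mu>)"
      proof (rule integral_cong_AE)
        show "AE y in \<mu>. (x \<bullet> y)\<^sup>2 = indicator {v, - v} y"
          using AE_U AE_space
        proof eventually_elim
          case (elim y)
          have "norm x = 1"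
            using v unit by auto
          then have "\<bar>x \<bullet> y\<bar> = 1 \<longleftrightarrow> y \<in> {x, - x}"
            using elim by (intro inner_unit_eq_pm1_iff) auto
          moreover have "x \<bullet> y \<in> {-1, 0, 1}"
            using inner[OF _ elim(1)] v by blast
          ultimately show ?case
            using v(2) by (auto simp: indicator_def)
        qed
      qed (use sets[OF v(1)] in measurable)
      then show ?case
        using prob v(1) sets[OF v(1)] sets.sets_into_space[OF sets[OF v(1)]] by (simp add: Int_absorb2)
    qed
  qed measurable
  ultimately show ?thesis
    using frame_potential by (simp add: energy_eq prob_space)
qed

end

end

section \<open>Existence of a maximizer and conclusion\<close>

lemma sphere_probs_iff: "\<mu> \<in> sphere_probs \<longleftrightarrow> sphere_prob \<mu>"
  by (auto simp: sphere_probs_def sphere_prob_def sphere_prob_axioms_def)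

text \<open>The witness is the uniform distribution on the standard basis, pushed forward to the
  sphere.\<close>

lemma Delta_eq_probs_nonempty: "(Delta_eq_probs :: 'a::euclidean_space measure set) \<noteq> {}"
proof -
  let ?S = "restrict_space borel (sphere (0::'a) 1)"
  define \<mu> where "\<mu> = distr (uniform_count_measure (Basis::'a set)) ?S (\<lambda>x. x)"
  have meas: "(\<lambda>x. x) \<in> measurable (uniform_count_measure (Basis::'a set)) ?S"
    by (auto simp: measurable_def space_uniform_count_measure sets_uniform_count_measure
        space_restrict_space)
  have \<mu>: "\<mu> \<in> sphere_probs"
    unfolding \<mu>_def sphere_probs_def
    by (auto intro!: prob_space.prob_space_distr prob_space_uniform_count_measure meas)
  have "measure \<mu> {v, - v} = 1 / real DIM('a)" if v: "v \<in> Basis" for v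
  proof -
    have "{v, - v} \<in> sets ?S"
      using v by (auto simp: sets_restrict_space_iff)
    \<comment> \<open>Hence \<open>{v, - v}\<close> meets the basis in \<open>v\<close> alone and
      has mass 1/N.\<close>
    moreover have "- v \<notin> Basis"
    proof
      assume "- v \<in> Basis"
      then have "0 \<le> (- v) \<bullet> v"
        using v by (simp add: inner_Basis del: inner_minus_left)
      then show False
        using v by simp
    qed
    ultimately show ?thesis
      unfolding \<mu>_def
      by (simp add: measure_distr[OF meas] space_uniform_count_measure
          measure_uniform_count_measure v Int_insert_left)
  qed
  moreover have "orthonormal_basis (Basis :: 'a set)"
    by (auto simp: orthonormal_basis_def pairwise_def orthogonal_def inner_Basis)
  ultimately show ?thesis
    using \<mu> unfolding Delta_eq_probs_def by blast
qed

theorem theoremA1: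
  fixes d :: nat and \<alpha> :: ereal
  assumes "d \<ge> 1" and "CARD('n::finite) = d + 1" and "\<alpha> \<ge> 2"
  shows "{\<mu> :: (real ^ 'n) measure. is_arg_max (energy \<alpha>) (\<lambda>\<nu>. \<nu> \<in> sphere_probs) \<mu>}
    = Delta_eq_probs"
proof -
  define M where "M = 1 / 2 * (1 - 1 / real DIM(real ^ 'n))"
  have le: "energy \<alpha> \<mu> \<le> M" if "\<mu> \<in> sphere_probs" for \<mu> :: "(real ^ 'n) measure"
    using that unfolding sphere_probs_iff M_def by (rule sphere_prob.energy_le[OF _ assms(3)])
  have eq: "\<mu> \<in> Delta_eq_probs \<longleftrightarrow> \<mu> \<in> sphere_probs \<and> energy \<alpha> \<mu> = M" for \<mu> :: "(real ^ 'n) measure"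
    using sphere_prob.Delta_eq_if_energy_eq[OF _ assms(3)]
      sphere_prob.energy_eq_if_Delta_eq[OF _ assms(3)]
    unfolding Delta_eq_probs_def M_def sphere_probs_iff by blast
  \<comment> \<open>Attainment of \<open>M\<close> is what makes every maximizer have energy exactly
    \<open>M\<close>, rather than merely at most \<open>M\<close>.\<close>
  obtain \<nu> :: "(real ^ 'n) measure" where "\<nu> \<in> Delta_eq_probs"
    using Delta_eq_probs_nonempty by blast
  then show ?thesis
    using le eq by (auto simp: is_arg_max_linorder intro: antisym)
qed

end
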